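(* Consider the statements (B-cp-ms), (NL-lin-qoms) and (AI-lin-rsms) given in the context. Then (B-cp-ms) is deducible from (NL-lin-qoms), (NL-lin-qoms) is deducible from (AI-lin-rsms), and (AI-lin-rsms) is deducible from (B-cp-ms). Hence (B-cp-ms), (NL-lin-qoms) and (AI-lin-rsms) are mutually equivalent.
   Context: "Deducible from" means "implied by", each statement being universally quantified over all the data it mentions. For a map $T:X\to X$, $\mathrm{Fix}(T)=\{x\in X:Tx=x\}$. $T$ is global strongly Picard (modulo $d$) if for each $x\in X$ the sequence $(T^nx)_{n\ge0}$ is $d$-convergent with limit in $\mathrm{Fix}(T)$, and $z_1,z_2\in\mathrm{Fix}(T)$ implies $z_1=z_2$. For a relation $\mathcal B$ on $X$: $x\mathcal B^\omega y$ iff there are $k\ge2$ and $z_1,\dots,z_k\in X$ with $z_1=x$, $z_k=y$, $z_i\mathcal B z_{i+1}$ for $1\le i\le k-1$; $T$ is $(d,\mathcal B;\lambda)$-contractive if $d(Tx,Ty)\le\lambda d(x,y)$ whenever $x\mathcal B y$; a sequence $(z_n)$ is $\mathcal B$-ascending if $z_i\mathcal B z_{i+1}$ for every $i$; $X$ is $(d,\mathcal B)$-complete if every $\mathcal B$-ascending $d$-Cauchy sequence is $d$-convergent in $X$; $\mathcal B$ is $d$-almost-selfclosed if, whenever $(z_n)$ is $\mathcal B$-ascending and $d$-converges to $z$, there is a subsequence $(w_n)$ of $(z_n)$ with $w_n\mathcal B z$ for all $n$; $T$ is $\mathcal B$-increasing if $x\mathcal B y$ implies $Tx\mathcal B Ty$;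 $T$ is $\mathcal B$-semi-progressive if $X(T,\mathcal B)=\{x\in X: x\mathcal B Tx\}$ is nonempty; $T$ is $\mathcal B^\omega$-global strongly Picard (modulo $(d,\mathcal B^\omega)$) if for each $x\in X(T,\mathcal B^\omega)$ the sequence $(T^nx)_{n\ge0}$ is $d$-convergent with limit in $\mathrm{Fix}(T)$, and for all $z_1,z_2\in\mathrm{Fix}(T)$, $z_1\mathcal B^\omega z_2$ implies $z_1=z_2$. A quasi-order is a reflexive and transitive relation. For a quasi-order $\le$ on $X$, $x<>y$ means: $x\le y$ or $y\le x$. The statements (with $X$ a nonempty set, $d$ a metric on $X$, $T:X\to X$): (B-cp-ms): if $X$ is $d$-complete and there is $\alpha\in[0,1)$ with $d(Tx,Ty)\le\alpha d(x,y)$ for all $x,y\in X$, then $T$ is global strongly Picard (modulo $d$). (NL-lin-qoms): for every quasi-order $\le$ on $X$, if $T$ is $(d,<>;\lambda)$-contractive for some $\lambda\in(0,1)$, $X$ is $(d,<>)$-complete, $<>$ is $d$-almost-selfclosed, and $T$ is $(<>)$-increasing and $(<>)^\omega$-semi-progressive, then $T$ is $(<>)^\omega$-global strongly Picard (modulo $(d,(<>)^\omega)$). (AI-lin-rsms): for every reflexive symmetric relation $\mathcal S$ on $X$, if $T$ is $(d,\mathcal S;\lambda)$-contractive for some $\lambda\in(0,1)$, $X$ is $(d,\mathcal S)$-complete, $\mathcal S$ is $d$-almost-selfclosed, and $T$ is $\mathcal S$-increasing and $\mathcal S^\omega$-semi-progressive, then $T$ is $\mathcal S^\omega$-global strongly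 Picard (modulo $(d,\mathcal S^\omega)$). *)

theory Defs
  imports "HOL-Analysis.Analysis"
begin

text \<open>
  A metric space is a carrier set \<open>X\<close> with a function \<open>d\<close> satisfying the library locale
  \<open>Metric_space\<close>; its symmetry and nonnegativity axioms also cover points outside the carrier.
  This is no restriction, since only the values of \<open>d\<close> on \<open>X\<close> are used below and any metric
  on \<open>X\<close> can be extended by zero. Relations on \<open>X\<close> are subsets of \<open>X \<times> X\<close>.
\<close>

definition Fix :: "'a set \<Rightarrow> ('a \<Rightarrow> 'a) \<Rightarrow> 'a set" where
  "Fix X T = {x \<in> X. T x = x}"

definition converges_to ::
    "'a set \<Rightarrow> ('a \<Rightarrow> 'a \<Rightarrow> real) \<Rightarrow> (nat \<Rightarrow> 'a) \<Rightarrow> 'a \<Rightarrow> bool" where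
  "converges_to X d z l \<longleftrightarrow> limitin (Metric_space.mtopology X d) z l sequentially"

definition global_strongly_Picard ::
    "'a set \<Rightarrow> ('a \<Rightarrow> 'a \<Rightarrow> real) \<Rightarrow> ('a \<Rightarrow> 'a) \<Rightarrow> bool" where
  "global_strongly_Picard X d T \<longleftrightarrow>
     (\<forall>x\<in>X. \<exists>l\<in>Fix X T. converges_to X d (\<lambda>n. (T ^^ n) x) l) \<and>
     (\<forall>z1\<in>Fix X T. \<forall>z2\<in>Fix X T. z1 = z2)"

text \<open>The relation \<open>\<B>\<^sup>\<omega>\<close>; the values of \<open>z\<close> outside \<open>{1..k}\<close> are irrelevant.\<close>

definition rel_omega :: "'a set \<Rightarrow> 'a rel \<Rightarrow> 'a rel" where
  "rel_omega X B = {(x, y). \<exists>k::nat. \<exists>z::nat \<Rightarrow> 'a. 2 \<le> k \<and> (\<forall>i\<in>{1..k}. z i \<in> X) \<and>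
     z 1 = x \<and> z k = y \<and> (\<forall>i\<in>{1..k - 1}. (z i, z (i + 1)) \<in> B)}"

definition contractive ::
    "'a set \<Rightarrow> ('a \<Rightarrow> 'a \<Rightarrow> real) \<Rightarrow> 'a rel \<Rightarrow> real \<Rightarrow> ('a \<Rightarrow> 'a) \<Rightarrow> bool" where
  "contractive X d B c T \<longleftrightarrow>
     (\<forall>x\<in>X. \<forall>y\<in>X. (x, y) \<in> B \<longrightarrow> d (T x) (T y) \<le> c * d x y)"

definition ascending :: "'a set \<Rightarrow> 'a rel \<Rightarrow> (nat \<Rightarrow> 'a) \<Rightarrow> bool" where
  "ascending X B z \<longleftrightarrow> range z \<subseteq> X \<and> (\<forall>i. (z i, z (Suc i)) \<in> B)"

definition rel_complete :: "'a set \<Rightarrow> ('a \<Rightarrow> 'a \<Rightarrow> real) \<Rightarrow> 'a rel \<Rightarrow> bool" where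
  "rel_complete X d B \<longleftrightarrow>
     (\<forall>z. ascending X B z \<and> Metric_space.MCauchy X d z \<longrightarrow> (\<exists>l\<in>X. converges_to X d z l))"

definition almost_selfclosed :: "'a set \<Rightarrow> ('a \<Rightarrow> 'a \<Rightarrow> real) \<Rightarrow> 'a rel \<Rightarrow> bool" where
  "almost_selfclosed X d B \<longleftrightarrow>
     (\<forall>z l. ascending X B z \<and> converges_to X d z l \<longrightarrow>
        (\<exists>\<phi>::nat \<Rightarrow> nat. strict_mono \<phi> \<and> (\<forall>n. (z (\<phi> n), l) \<in> B)))"

definition rel_increasing :: "'a set \<Rightarrow> 'a rel \<Rightarrow> ('a \<Rightarrow> 'a) \<Rightarrow> bool" where
  "rel_increasing X B T \<longleftrightarrow> (\<forall>x\<in>X. \<forall>y\<in>X. (x, y) \<in> B \<longrightarrow> (T x, T y) \<in> B)"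

definition progressive_points :: "'a set \<Rightarrow> ('a \<Rightarrow> 'a) \<Rightarrow> 'a rel \<Rightarrow> 'a set" where
  "progressive_points X T B = {x \<in> X. (x, T x) \<in> B}"

definition semi_progressive :: "'a set \<Rightarrow> 'a rel \<Rightarrow> ('a \<Rightarrow> 'a) \<Rightarrow> bool" where
  "semi_progressive X B T \<longleftrightarrow> progressive_points X T B \<noteq> {}"

text \<open>Being \<open>\<B>\<^sup>\<omega>\<close>-global strongly Picard is the following notion at \<open>R = \<B>\<^sup>\<omega>\<close>.\<close>

definition rel_global_strongly_Picard ::
    "'a set \<Rightarrow> ('a \<Rightarrow> 'a \<Rightarrow> real) \<Rightarrow> 'a rel \<Rightarrow> ('a \<Rightarrow> 'a) \<Rightarrow> bool" where
  "rel_global_strongly_Picard X d R T \<longleftrightarrow>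
     (\<forall>x\<in>progressive_points X T R. \<exists>l\<in>Fix X T. converges_to X d (\<lambda>n. (T ^^ n) x) l) \<and>
     (\<forall>z1\<in>Fix X T. \<forall>z2\<in>Fix X T. (z1, z2) \<in> R \<longrightarrow> z1 = z2)"

definition comparable :: "'a rel \<Rightarrow> 'a rel" where
  "comparable r = {(x, y). (x, y) \<in> r \<or> (y, x) \<in> r}"

text \<open>
  Each of the three fixed point statements is universally quantified over all its data. As HOL
  has no quantification over types inside formulas, the sets \<open>X\<close> range over the nonempty
  subsets of a type \<open>'a\<close>, which is passed as an argument and is arbitrary.
\<close>

definition B_cp_ms :: "'a itself \<Rightarrow> bool" where
  "B_cp_ms (_ :: 'a itself) \<longleftrightarrow>
     (\<forall>(X :: 'a set) d T.
        X \<noteq> {} \<and> Metric_space X d \<and> T \<in> X \<rightarrow> X \<longrightarrow>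
        Metric_space.mcomplete X d \<and>
        (\<exists>\<alpha>. 0 \<le> \<alpha> \<and> \<alpha> < 1 \<and> (\<forall>x\<in>X. \<forall>y\<in>X. d (T x) (T y) \<le> \<alpha> * d x y)) \<longrightarrow>
        global_strongly_Picard X d T)"

definition NL_lin_qoms :: "'a itself \<Rightarrow> bool" where
  "NL_lin_qoms (_ :: 'a itself) \<longleftrightarrow>
     (\<forall>(X :: 'a set) d T.
        X \<noteq> {} \<and> Metric_space X d \<and> T \<in> X \<rightarrow> X \<longrightarrow>
        (\<forall>r. preorder_on X r \<longrightarrow>
           (\<exists>c. 0 < c \<and> c < 1 \<and> contractive X d (comparable r) c T) \<and>
           rel_complete X d (comparable r) \<and>
           almost_selfclosed X d (comparable r) \<and>
           rel_increasing X (comparable r) T \<and>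
           semi_progressive X (rel_omega X (comparable r)) T \<longrightarrow>
           rel_global_strongly_Picard X d (rel_omega X (comparable r)) T))"

definition AI_lin_rsms :: "'a itself \<Rightarrow> bool" where
  "AI_lin_rsms (_ :: 'a itself) \<longleftrightarrow>
     (\<forall>(X :: 'a set) d T.
        X \<noteq> {} \<and> Metric_space X d \<and> T \<in> X \<rightarrow> X \<longrightarrow>
        (\<forall>S. S \<subseteq> X \<times> X \<and> refl_on X S \<and> sym S \<longrightarrow>
           (\<exists>c. 0 < c \<and> c < 1 \<and> contractive X d S c T) \<and>
           rel_complete X d S \<and>
           almost_selfclosed X d S \<and>
           rel_increasing X S T \<and>
           semi_progressive X (rel_omega X S) T \<longrightarrow>
           rel_global_strongly_Picard X d (rel_omega X S) T))"

end

theory Submission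
  imports Defs
begin

text \<open>
  Banach's principle implies the relational statement by a change of metric. Let \<open>S\<close> be a
  reflexive symmetric relation on \<open>(X, d)\<close>. Its transitive closure \<open>S\<^sup>+\<close>, which is
  \<open>S\<^sup>\<omega>\<close>, is an equivalence relation, and on each of its classes the infimum \<open>e\<close> of the
  \<open>d\<close>-lengths of the \<open>S\<close>-chains joining two points is a metric with \<open>d \<le> e\<close>, where
  \<open>e \<le> d\<close> on pairs in \<open>S\<close>. A map that is increasing and contracts \<open>d\<close> along \<open>S\<close> by a
  factor \<open>c\<close> sends a chain of length \<open>s\<close> to a chain of length at most \<open>c s\<close>, so it contracts \<open>e\<close>
  for any two points of one class.

  The remaining point is that a class \<open>Y\<close> is complete for \<open>e\<close> (\<open>chain_metric_mcomplete\<close>).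
  A Cauchy sequence may be thinned out so that consecutive terms are joined by chains of
  summable lengths; concatenating these chains gives an ascending sequence of finite
  \<open>d\<close>-length, hence a \<open>d\<close>-Cauchy one. Relative completeness supplies a \<open>d\<close>-limit, and almost
  selfclosedness makes infinitely many terms \<open>S\<close>-related to this limit. Therefore the limit lies
  in \<open>Y\<close>, and along those terms \<open>e \<le> d\<close> turns \<open>d\<close>-convergence into \<open>e\<close>-convergence.

  If \<open>x\<close> is joined to \<open>T x\<close> by a chain, then \<open>T\<close> maps the class of \<open>x\<close> into itself, and Banach's
  principle there gives the limit of the orbit of \<open>x\<close>. Two fixed points joined by a chain lie in
  one such class, so they coincide.

  The other two deductions are specializations: \<open><>\<close> is reflexive and symmetric for every
  quasi-order, and the quasi-order \<open>X \<times> X\<close> makes every relational hypothesis an absolute one.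
\<close>

section \<open>Sequences in metric spaces\<close>

lemma (in Metric_space) dist_le_sum_steps:
  assumes "range z \<subseteq> M" and "m \<le> n"
  shows "d (z m) (z n) \<le> (\<Sum>j=m..<n. d (z j) (z (Suc j)))"
  using assms(2)
proof (induction n rule: dec_induct)
  case base
  then show ?case using assms(1) by (simp add: range_subsetD)
next
  case (step n)
  have "d (z m) (z (Suc n)) \<le> d (z m) (z n) + d (z n) (z (Suc n))"
    using assms(1) by (intro triangle) auto
  then show ?case using step by simp
qed

lemma (in Metric_space) MCauchy_if_summable_steps:
  assumes "range z \<subseteq> M" and "summable (\<lambda>j. d (z j) (z (Suc j)))"
  shows "MCauchy z"
  unfolding MCauchy_def
proof (intro conjI allI impI)
  fix \<epsilon> :: real assume "\<epsilon> > 0"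
  with assms(2) obtain N where
    N: "\<And>m n. N \<le> m \<Longrightarrow> norm (\<Sum>j=m..<n. d (z j) (z (Suc j))) < \<epsilon>"
    unfolding summable_Cauchy by blast
  have less: "d (z m) (z n) < \<epsilon>" if "N \<le> m" "m \<le> n" for m n
    using dist_le_sum_steps[OF assms(1) that(2)] N[OF that(1), of n] by simp
  have "d (z m) (z n) < \<epsilon>" if "N \<le> m" "N \<le> n" for m n
    using less[of m n] less[of n m] that commute[of "z m" "z n"] by linarith
  then show "\<exists>N. \<forall>n n'. N \<le> n \<longrightarrow> N \<le> n' \<longrightarrow> d (z n) (z n') < \<epsilon>" by blast
qed (use assms in auto)

lemma (in Metric_space) MCauchy_fast_subsequence:
  assumes "MCauchy \<sigma>"
  obtains r where "strict_mono r" and "\<And>n. d (\<sigma> (r n)) (\<sigma> (r (Suc n))) < (1 / 2) ^ n"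
proof -
  have tail: "\<exists>N. \<forall>m\<ge>N. \<forall>m'\<ge>N. d (\<sigma> m) (\<sigma> m') < (1 / 2) ^ n" for n :: nat
    using assms unfolding MCauchy_def by (meson zero_less_divide_1_iff zero_less_numeral zero_less_power)
  have "\<exists>r. \<forall>n. (\<forall>m\<ge>r n. d (\<sigma> (r n)) (\<sigma> m) < (1 / 2) ^ n) \<and> r n < r (Suc n)"
  proof (rule dependent_nat_choice)
    show "\<exists>N. \<forall>m\<ge>N. d (\<sigma> N) (\<sigma> m) < (1 / 2) ^ 0"
      using tail[of 0] by blast
  next
    fix a n
    obtain N where N: "\<forall>m\<ge>N. \<forall>m'\<ge>N. d (\<sigma> m) (\<sigma> m') < (1 / 2) ^ Suc n"
      using tail[of "Suc n"] by blast
    show "\<exists>b. (\<forall>m\<ge>b. d (\<sigma> b) (\<sigma> m) < (1 / 2) ^ Suc n) \<and> a < b"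
      by (rule exI[of _ "max N (Suc a)"]) (use N in auto)
  qed
  then obtain r where r: "\<And>n m. m \<ge> r n \<Longrightarrow> d (\<sigma> (r n)) (\<sigma> m) < (1 / 2) ^ n"
    "\<And>n. r n < r (Suc n)" by blast
  show thesis
  proof
    show "strict_mono r" using r(2) by (simp add: strict_mono_Suc_iff)
    show "d (\<sigma> (r n)) (\<sigma> (r (Suc n))) < (1 / 2) ^ n" for n
      using r by (simp add: less_imp_le)
  qed
qed

section \<open>Concatenation of infinitely many finite blocks\<close>

text \<open>
  Walking through consecutive blocks of lengths \<open>k 0, k 1, \<dots>\<close>, the state after \<open>j\<close> steps is the
  pair of the current block and the position inside it.
\<close>

primrec block_position :: "(nat \<Rightarrow> nat) \<Rightarrow> nat \<Rightarrow> nat \<times> nat" where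
  "block_position k 0 = (0, 0)"
| "block_position k (Suc j) =
     (let (n, i) = block_position k j in if Suc i < k n then (n, Suc i) else (Suc n, 0))"

lemma block_position_eq:
  assumes "\<And>n. 0 < k n" and "i < k n"
  shows "block_position k (sum k {..<n} + i) = (n, i)"
  using assms(2)
proof (induction n arbitrary: i)
  case 0
  then show ?case by (induction i) auto
next
  case (Suc n)
  have start: "block_position k (sum k {..<Suc n}) = (Suc n, 0)"
  proof -
    have "block_position k (sum k {..<n} + (k n - 1)) = (n, k n - 1)"
      using assms(1)[of n] by (intro Suc.IH) simp
    moreover have "sum k {..<Suc n} = Suc (sum k {..<n} + (k n - 1))"
      using assms(1)[of n] by simp
    ultimately show ?thesis using assms(1)[of n] by (simp only: block_position.simps) simp
  qed
  show ?case
    using Suc.prems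
  proof (induction i)
    case 0
    then show ?case using start by simp
  next
    case (Suc i)
    then show ?case by (simp del: sum.lessThan_Suc)
  qed
qed

lemma ex_block_of_index:
  fixes k :: "nat \<Rightarrow> nat"
  assumes "\<And>n. 0 < k n"
  shows "\<exists>n i. i < k n \<and> j = sum k {..<n} + i"
proof (induction j)
  case 0
  show ?case by (rule exI[of _ 0]) (use assms in auto)
next
  case (Suc j)
  then obtain n i where ni: "i < k n" "j = sum k {..<n} + i" by blast
  show ?case
  proof (cases "Suc i < k n")
    case True
    then show ?thesis using ni by (metis add_Suc_right)
  next
    case False
    then have "Suc j = sum k {..<Suc n} + 0" using ni by simp
    then show ?thesis using assms by blast
  qed
qed

text \<open>
  Consecutive blocks share an endpoint, so the formula for the concatenation extends to \<open>i = k n\<close>,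
  although \<open>block_position\<close> assigns that index to the next block.
\<close>

lemma concatenate_blocks:
  fixes c :: "nat \<Rightarrow> nat \<Rightarrow> 'a"
  assumes pos: "\<And>n. 0 < k n" and link: "\<And>n. c n (k n) = c (Suc n) 0"
  obtains y where "\<And>n i. i \<le> k n \<Longrightarrow> y (sum k {..<n} + i) = c n i"
proof
  fix n i assume "i \<le> k n"
  show "(\<lambda>j. case block_position k j of (n, i) \<Rightarrow> c n i) (sum k {..<n} + i) = c n i"
  proof (cases "i < k n")
    case True
    then show ?thesis using block_position_eq[of k i n, OF pos] by simp
  next
    case False
    with \<open>i \<le> k n\<close> have i: "i = k n" by simp
    have "block_position k (sum k {..<n} + k n) = (Suc n, 0)"
      using block_position_eq[of k 0 "Suc n", OF pos pos] by simp
    then show ?thesis using i link[of n] by simp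
  qed
qed

lemma sum_lessThan_blocks:
  fixes f :: "nat \<Rightarrow> real" and k :: "nat \<Rightarrow> nat"
  shows "sum f {..<sum k {..<n}} = (\<Sum>m<n. \<Sum>i<k m. f (sum k {..<m} + i))"
proof (induction n)
  case (Suc n)
  have "sum f {..<a + b} = sum f {..<a} + (\<Sum>i<b. f (a + i))" for a b
    by (induction b) auto
  then show ?case using Suc by simp
qed simp

section \<open>Chains and their lengths\<close>

inductive chain_of_length :: "('a \<Rightarrow> 'a \<Rightarrow> real) \<Rightarrow> 'a rel \<Rightarrow> 'a \<Rightarrow> 'a \<Rightarrow> real \<Rightarrow> bool"
  for d S where
  link: "(x, y) \<in> S \<Longrightarrow> chain_of_length d S x y (d x y)"
| step: "(x, y) \<in> S \<Longrightarrow> chain_of_length d S y z s \<Longrightarrow> chain_of_length d S x z (d x y + s)"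

lemma chain_of_length_imp_trancl: "chain_of_length d S x y s \<Longrightarrow> (x, y) \<in> S\<^sup>+"
  by (induction rule: chain_of_length.induct) auto

lemma trancl_imp_chain_of_length: "(x, y) \<in> S\<^sup>+ \<Longrightarrow> \<exists>s. chain_of_length d S x y s"
  by (induction rule: converse_trancl_induct) (blast intro: chain_of_length.intros)+

lemma chain_of_length_append:
  assumes "chain_of_length d S x y s" and "chain_of_length d S y z t"
  shows "chain_of_length d S x z (s + t)"
  using assms by induction (auto simp: add.assoc intro: chain_of_length.intros)

lemma chain_of_length_reverse:
  assumes "chain_of_length d S x y s" and "sym S" and "\<And>x y. d x y = d y x"
  shows "chain_of_length d S y x s"
  using assms(1)
proof induction
  case (link x y)
  then show ?case using assms(2,3) by (metis chain_of_length.link symD)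
next
  case (step x y z s)
  have "chain_of_length d S y x (d x y)"
    using step.hyps(1) assms(2,3) by (metis chain_of_length.link symD)
  then show ?case using chain_of_length_append[OF step.IH] by (metis add.commute)
qed

lemma chain_of_length_nonneg:
  assumes "chain_of_length d S x y s" and "\<And>x y. 0 \<le> d x y"
  shows "0 \<le> s"
  using assms(1) by induction (auto simp: assms(2))

lemma chain_of_length_contract:
  assumes "chain_of_length d S x y s"
    and "\<And>x y. (x, y) \<in> S \<Longrightarrow> (T x, T y) \<in> S \<and> d (T x) (T y) \<le> c * d x y"
  shows "\<exists>t \<le> c * s. chain_of_length d S (T x) (T y) t"
  using assms(1)
proof induction
  case (link x y)
  then show ?case using assms(2) by (blast intro: chain_of_length.link)
next
  case (step x y z s)
  then obtain t where "t \<le> c * s" "chain_of_length d S (T y) (T z) t" by blast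
  with assms(2)[OF step.hyps(1)] show ?case
    by (intro exI[of _ "d (T x) (T y) + t"])
       (auto simp: distrib_left intro: add_mono chain_of_length.step)
qed

text \<open>The vertices of a chain, listed in order, are the form in which chains are concatenated.\<close>

lemma chain_of_length_vertices:
  assumes "chain_of_length d S x y s"
  shows "\<exists>k c. 0 < k \<and> c 0 = x \<and> c k = y \<and> (\<forall>i<k. (c i, c (Suc i)) \<in> S) \<and>
           (\<Sum>i<k. d (c i) (c (Suc i))) = s"
  using assms
proof induction
  case (link x y)
  then show ?case by (intro exI[of _ 1] exI[of _ "\<lambda>i. if i = 0 then x else y"]) auto
next
  case (step x y z s)
  then obtain k c where kc: "0 < k" "c 0 = y" "c k = z" "\<forall>i<k. (c i, c (Suc i)) \<in> S"
    "(\<Sum>i<k. d (c i) (c (Suc i))) = s" by blast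
  have "\<forall>i<Suc k. (case_nat x c i, case_nat x c (Suc i)) \<in> S"
    using kc step.hyps(1) by (auto split: nat.split)
  moreover have "(\<Sum>i<Suc k. d (case_nat x c i) (case_nat x c (Suc i))) = d x y + s"
    using kc by (subst sum.lessThan_Suc_shift) simp
  ultimately show ?case
    using kc by (intro exI[of _ "Suc k"] exI[of _ "case_nat x c"]) simp
qed

lemma rel_omega_eq_trancl:
  assumes "S \<subseteq> X \<times> X"
  shows "rel_omega X S = S\<^sup>+"
proof (intro subset_antisym subrelI)
  fix x y assume "(x, y) \<in> rel_omega X S"
  then obtain k :: nat and z where kz: "2 \<le> k" "z 1 = x" "z k = y"
    "\<forall>i\<in>{1..k - 1}. (z i, z (i + 1)) \<in> S"
    unfolding rel_omega_def by blast
  have "(z (Suc 0), z (Suc (k - 1))) \<in> S ^^ (k - 1)"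
    unfolding relpow_fun_conv using kz by (intro exI[of _ "\<lambda>i. z (Suc i)"]) auto
  then show "(x, y) \<in> S\<^sup>+"
    unfolding trancl_power using kz by (intro exI[of _ "k - 1"]) auto
next
  fix x y assume xy: "(x, y) \<in> S\<^sup>+"
  then obtain n f where nf: "0 < n" "f 0 = x" "f n = y" "\<forall>i<n. (f i, f (Suc i)) \<in> S"
    unfolding trancl_power relpow_fun_conv by blast
  have "f i \<in> X" if "i \<le> n" for i
  proof (cases "i < n")
    case True
    then show ?thesis using nf assms by blast
  next
    case False
    with that have "i = Suc (n - 1)" "n - 1 < n" using nf(1) by auto
    then show ?thesis using nf(4) assms by blast
  qed
  moreover have "(f (i - 1), f i) \<in> S" if "i \<in> {1..n}" for i
    using nf(4)[rule_format, of "i - 1"] that by auto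
  ultimately show "(x, y) \<in> rel_omega X S"
    unfolding rel_omega_def using nf
    by (intro CollectI case_prodI exI[of _ "Suc n"] exI[of _ "\<lambda>i. f (i - 1)"]) auto
qed

section \<open>The chain metric\<close>

locale reflexive_symmetric_metric = Metric_space X d for X :: "'a set" and d +
  fixes S :: "'a rel"
  assumes S_subset: "S \<subseteq> X \<times> X" and S_refl: "refl_on X S" and S_sym: "sym S"
begin

abbreviation chain :: "'a \<Rightarrow> 'a \<Rightarrow> real \<Rightarrow> bool" where
  "chain \<equiv> chain_of_length d S"

text \<open>
  The value \<open>0\<close> for points that no chain joins serves only to make \<open>chain_metric\<close> nonnegative and
  symmetric on the whole type.
\<close>

definition chain_metric :: "'a \<Rightarrow> 'a \<Rightarrow> real" where
  "chain_metric x y = (if (x, y) \<in> S\<^sup>+ then Inf {s. chain x y s} else 0)"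

definition component :: "'a \<Rightarrow> 'a set" where
  "component x = {y. (x, y) \<in> S\<^sup>+}"

lemma trancl_in_carrier: "(x, y) \<in> S\<^sup>+ \<Longrightarrow> x \<in> X \<and> y \<in> X"
  using trancl_subset_Sigma[OF S_subset] by blast

lemma sym_trancl_S: "sym (S\<^sup>+)"
  using S_sym by (rule sym_trancl)

lemma component_subset: "component x \<subseteq> X"
  unfolding component_def using trancl_in_carrier by blast

lemma component_joined: "y \<in> component x \<Longrightarrow> z \<in> component x \<Longrightarrow> (y, z) \<in> S\<^sup>+"
  unfolding component_def by (metis mem_Collect_eq symD sym_trancl_S trancl_trans)

lemma chain_metric_le:
  assumes "chain x y s"
  shows "chain_metric x y \<le> s"
proof -
  have "bdd_below {s. chain x y s}"
    by (rule bdd_belowI[of _ 0]) (auto intro: chain_of_length_nonneg)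
  then show ?thesis
    unfolding chain_metric_def using assms chain_of_length_imp_trancl[OF assms]
    by (auto intro: cInf_lower)
qed

lemma chain_metric_greatest:
  assumes "(x, y) \<in> S\<^sup>+" and "\<And>s. chain x y s \<Longrightarrow> b \<le> s"
  shows "b \<le> chain_metric x y"
  unfolding chain_metric_def
  using assms trancl_imp_chain_of_length[OF assms(1), of d] by (auto intro: cInf_greatest)

lemma chain_metric_approx:
  assumes "(x, y) \<in> S\<^sup>+" and "chain_metric x y < b"
  shows "\<exists>s<b. chain x y s"
  using chain_metric_greatest[OF assms(1), of b] assms(2) by (meson not_le)

lemma chain_metric_le_dist: "(x, y) \<in> S \<Longrightarrow> chain_metric x y \<le> d x y"
  by (simp add: chain_metric_le chain_of_length.link)

lemma dist_le_chain_metric: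
  assumes "(x, y) \<in> S\<^sup>+"
  shows "d x y \<le> chain_metric x y"
proof (rule chain_metric_greatest[OF assms])
  fix s assume "chain x y s"
  then show "d x y \<le> s"
  proof induction
    case (step x y z s)
    have "x \<in> X" "y \<in> X" "z \<in> X"
      using step.hyps(1) S_subset trancl_in_carrier[OF chain_of_length_imp_trancl[OF step.hyps(2)]]
      by auto
    then have "d x z \<le> d x y + d y z" by (rule triangle)
    then show ?case using step.IH by linarith
  qed simp
qed

lemma chain_metric_is_metric: "Metric_space (component x) chain_metric"
proof
  fix y z
  show "0 \<le> chain_metric y z"
    using chain_metric_greatest[of y z 0] chain_of_length_nonneg[of d S y z]
    by (cases "(y, z) \<in> S\<^sup>+") (auto simp: chain_metric_def)
  have "chain y z s \<longleftrightarrow> chain z y s" for s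
    using chain_of_length_reverse[of d S] S_sym commute by blast
  moreover have "(y, z) \<in> S\<^sup>+ \<longleftrightarrow> (z, y) \<in> S\<^sup>+"
    by (metis symD sym_trancl_S)
  ultimately show "chain_metric y z = chain_metric z y"
    unfolding chain_metric_def by presburger
next
  fix y z assume yz: "y \<in> component x" "z \<in> component x"
  then have joined: "(y, z) \<in> S\<^sup>+" and X: "y \<in> X" "z \<in> X"
    using component_joined component_subset by blast+
  show "chain_metric y z = 0 \<longleftrightarrow> y = z"
  proof
    assume "chain_metric y z = 0"
    then have "d y z \<le> 0" using dist_le_chain_metric[OF joined] by simp
    then have "d y z = 0" using nonneg[of y z] by linarith
    then show "y = z" using X by simp
  next
    assume "y = z"
    moreover have "(z, z) \<in> S" using S_refl X by (auto simp: refl_on_def)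
    ultimately show "chain_metric y z = 0"
      using chain_metric_le_dist[of z z] dist_le_chain_metric[OF joined] X by simp
  qed
next
  fix u v w assume uvw: "u \<in> component x" "v \<in> component x" "w \<in> component x"
  show "chain_metric u w \<le> chain_metric u v + chain_metric v w"
  proof (rule field_le_epsilon)
    fix \<epsilon> :: real assume "\<epsilon> > 0"
    obtain s where s: "s < chain_metric u v + \<epsilon> / 2" "chain u v s"
      using chain_metric_approx[of u v] component_joined uvw \<open>\<epsilon> > 0\<close>
      by (metis half_gt_zero less_add_same_cancel1)
    obtain t where t: "t < chain_metric v w + \<epsilon> / 2" "chain v w t"
      using chain_metric_approx[of v w] component_joined uvw \<open>\<epsilon> > 0\<close>
      by (metis half_gt_zero less_add_same_cancel1)
    have "chain_metric u w \<le> s + t"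
      by (rule chain_metric_le[OF chain_of_length_append[OF s(2) t(2)]])
    then show "chain_metric u w \<le> chain_metric u v + chain_metric v w + \<epsilon>"
      using s(1) t(1) by argo
  qed
qed

lemma chain_metric_contraction:
  assumes "(x, y) \<in> S\<^sup>+" and "0 < c"
    and "\<And>x y. (x, y) \<in> S \<Longrightarrow> (T x, T y) \<in> S \<and> d (T x) (T y) \<le> c * d x y"
  shows "chain_metric (T x) (T y) \<le> c * chain_metric x y"
proof -
  have "chain_metric (T x) (T y) / c \<le> chain_metric x y"
  proof (rule chain_metric_greatest[OF assms(1)])
    fix s assume "chain x y s"
    then obtain t where "t \<le> c * s" "chain (T x) (T y) t"
      using chain_of_length_contract[OF _ assms(3)] by metis
    then have "chain_metric (T x) (T y) \<le> c * s"
      using chain_metric_le order_trans by blast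
    then show "chain_metric (T x) (T y) / c \<le> s"
      using assms(2) by (simp add: divide_le_eq mult.commute)
  qed
  then show ?thesis using assms(2) by (simp add: divide_le_eq mult.commute)
qed

text \<open>
  A sequence whose consecutive chain distances are dominated by a convergent geometric series
  extends to an ascending sequence of finite length, by filling each gap with a nearly optimal
  chain.
\<close>

lemma ascending_refinement:
  assumes joined: "\<And>n. (z n, z (Suc n)) \<in> S\<^sup>+"
    and fast: "\<And>n. chain_metric (z n) (z (Suc n)) < (1 / 2) ^ n"
  obtains r y where "strict_mono r" and "\<And>n. y (r n) = z n" and "ascending X S y"
    and "summable (\<lambda>j. d (y j) (y (Suc j)))"
proof -
  let ?P = "\<lambda>n k c. 0 < k \<and> c 0 = z n \<and> c k = z (Suc n) \<and>
    (\<forall>i<k. (c i, c (Suc i)) \<in> S) \<and> (\<Sum>i<k. d (c i) (c (Suc i))) \<le> (1 / 2) ^ n"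
  have "\<exists>k c. ?P n k c" for n
  proof -
    obtain s where s: "s < (1 / 2) ^ n" "chain (z n) (z (Suc n)) s"
      using chain_metric_approx[OF joined fast] by blast
    from chain_of_length_vertices[OF s(2)] obtain k c
      where "0 < k" "c 0 = z n" "c k = z (Suc n)" "\<forall>i<k. (c i, c (Suc i)) \<in> S"
        "(\<Sum>i<k. d (c i) (c (Suc i))) = s" by blast
    with s(1) have "?P n k c" by simp
    then show ?thesis by blast
  qed
  then have "\<forall>n. \<exists>p. ?P n (fst p) (snd p)" by simp
  from choice[OF this] obtain p where p: "\<And>n. ?P n (fst (p n)) (snd (p n))" by blast
  define k where "k n = fst (p n)" for n
  define c where "c n = snd (p n)" for n
  have k: "0 < k n" and c0: "c n 0 = z n" and ck: "c n (k n) = z (Suc n)"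
    and clen: "(\<Sum>i<k n. d (c n i) (c n (Suc i))) \<le> (1 / 2) ^ n" for n
    using p[of n] unfolding k_def c_def by simp_all
  have cS: "(c n i, c n (Suc i)) \<in> S" if "i < k n" for n i
    using p[of n] that unfolding k_def c_def by simp
  have "c n (k n) = c (Suc n) 0" for n by (simp add: c0 ck)
  from concatenate_blocks[of k c, OF k this]
  obtain y where y: "\<And>n i. i \<le> k n \<Longrightarrow> y (sum k {..<n} + i) = c n i" by blast
  define r where "r n = sum k {..<n}" for n
  have r_mono: "strict_mono r"
    unfolding strict_mono_Suc_iff r_def using k by simp
  have y_step: "y (r n + i) = c n i" "y (Suc (r n + i)) = c n (Suc i)" if "i < k n" for n i
    using y[of i n] y[of "Suc i" n] that unfolding r_def by auto
  have yS: "(y j, y (Suc j)) \<in> S" for j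
  proof -
    obtain n i where "i < k n" "j = r n + i"
      using ex_block_of_index[of k j, OF k] unfolding r_def by blast
    then show ?thesis using y_step[of i n] cS[of i n] by simp
  qed
  have "(\<Sum>j<N. d (y j) (y (Suc j))) \<le> 2" for N
  proof -
    have "(\<Sum>j<N. d (y j) (y (Suc j))) \<le> (\<Sum>j<r N. d (y j) (y (Suc j)))"
      using strict_mono_imp_increasing[OF r_mono, of N] by (intro sum_mono2) auto
    also have "\<dots> = (\<Sum>n<N. \<Sum>i<k n. d (y (r n + i)) (y (Suc (r n + i))))"
      unfolding r_def by (rule sum_lessThan_blocks)
    also have "\<dots> = (\<Sum>n<N. \<Sum>i<k n. d (c n i) (c n (Suc i)))"
      by (intro sum.cong refl) (simp add: y_step)
    also have "\<dots> \<le> (\<Sum>n<N. (1 / 2) ^ n)"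
      by (intro sum_mono clen)
    also have "\<dots> \<le> 2"
      by (simp add: geometric_sum)
    finally show ?thesis .
  qed
  then have summ: "summable (\<lambda>j. d (y j) (y (Suc j)))"
    by (intro summableI_nonneg_bounded[of _ 2]) auto
  show thesis
  proof (rule that[OF r_mono _ _ summ])
    show "y (r n) = z n" for n
      using y[of 0 n] c0 by (simp add: r_def)
    show "ascending X S y"
      unfolding ascending_def using yS S_subset by blast
  qed
qed

lemma chain_metric_mcomplete:
  assumes compl: "rel_complete X d S" and closed: "almost_selfclosed X d S"
  shows "Metric_space.mcomplete (component x) chain_metric"
proof -
  interpret E: Metric_space "component x" chain_metric
    by (rule chain_metric_is_metric)
  show ?thesis
    unfolding E.mcomplete_def
  proof (intro allI impI)
    fix \<sigma> assume \<sigma>: "E.MCauchy \<sigma>"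
    obtain q where q: "strict_mono q"
      and fast: "\<And>n. chain_metric (\<sigma> (q n)) (\<sigma> (q (Suc n))) < (1 / 2) ^ n"
      using E.MCauchy_fast_subsequence[OF \<sigma>] by blast
    have \<sigma>_in: "\<sigma> n \<in> component x" for n
      using \<sigma> unfolding E.MCauchy_def by blast
    obtain r y where r: "strict_mono r" and yr: "\<And>n. y (r n) = \<sigma> (q n)"
      and asc: "ascending X S y" and summ: "summable (\<lambda>j. d (y j) (y (Suc j)))"
      by (rule ascending_refinement[OF component_joined[OF \<sigma>_in \<sigma>_in] fast]) (rule that)
    have yX: "range y \<subseteq> X" and yS: "\<And>j. (y j, y (Suc j)) \<in> S"
      using asc unfolding ascending_def by auto
    have y_in: "y j \<in> component x" for j
    proof -
      have later: "(y i, y (i + m)) \<in> S\<^sup>+" for i m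
      proof (induction m)
        case 0
        have "(y i, y i) \<in> S" using yX S_refl by (auto simp: refl_on_def)
        then show ?case by simp
      next
        case (Suc m)
        then show ?case using trancl_into_trancl[OF Suc.IH yS[of "i + m"]] by simp
      qed
      have "(y j, \<sigma> (q j)) \<in> S\<^sup>+"
        unfolding yr[symmetric] using later[of j "r j - j"] strict_mono_imp_increasing[OF r, of j] by simp
      then have "(\<sigma> (q j), y j) \<in> S\<^sup>+"
        by (rule symD[OF sym_trancl_S])
      with \<sigma>_in[of "q j"] show ?thesis
        unfolding component_def mem_Collect_eq by (rule trancl_trans)
    qed
    have "MCauchy y"
      using yX summ by (rule MCauchy_if_summable_steps)
    then obtain l where "converges_to X d y l"
      using compl[unfolded rel_complete_def, rule_format, of y] asc by auto
    then have "\<exists>\<phi>::nat \<Rightarrow> nat. strict_mono \<phi> \<and> (\<forall>n. (y (\<phi> n), l) \<in> S)"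
      using closed[unfolded almost_selfclosed_def, rule_format, of y l] asc by simp
    then obtain \<phi> :: "nat \<Rightarrow> nat"
      where \<phi>: "strict_mono \<phi>" and \<phi>S: "\<And>n. (y (\<phi> n), l) \<in> S"
      by (elim exE conjE) (rule that, auto)
    have l_in: "l \<in> component x"
      using trancl_into_trancl[OF _ \<phi>S[of 0]] y_in[of "\<phi> 0"] by (simp add: component_def)
    \<comment> \<open>The steps of \<open>y\<close> lie in \<open>S\<close>, so \<open>y\<close> is Cauchy for the chain metric as well; it is enough
      to find the limit along \<open>\<phi>\<close>.\<close>
    have "summable (\<lambda>j. chain_metric (y j) (y (Suc j)))"
      using summ by (rule summable_comparison_test[rotated]) (simp add: chain_metric_le_dist yS)
    then have y_cauchy: "E.MCauchy y"
      using y_in by (intro E.MCauchy_if_summable_steps) auto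
    have "limitin mtopology (y \<circ> \<phi>) l sequentially"
      using \<open>converges_to X d y l\<close> \<phi> unfolding converges_to_def by (simp add: limitin_subsequence)
    then have d_lim: "\<forall>\<epsilon>>0. \<exists>N. \<forall>n\<ge>N. d (y (\<phi> n)) l < \<epsilon>"
      unfolding limit_metric_sequentially comp_apply by meson
    have "limitin E.mtopology (y \<circ> \<phi>) l sequentially"
      unfolding E.limit_metric_sequentially
    proof (intro conjI allI impI)
      fix \<epsilon> :: real assume "\<epsilon> > 0"
      with d_lim obtain N where N: "\<And>n. N \<le> n \<Longrightarrow> d (y (\<phi> n)) l < \<epsilon>" by blast
      have "chain_metric (y (\<phi> n)) l < \<epsilon>" if "N \<le> n" for n
        using chain_metric_le_dist[OF \<phi>S] N[OF that] by (rule le_less_trans)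
      then show "\<exists>N. \<forall>n\<ge>N. (y \<circ> \<phi>) n \<in> component x \<and> chain_metric ((y \<circ> \<phi>) n) l < \<epsilon>"
        using y_in by auto
    qed (rule l_in)
    then have "limitin E.mtopology y l sequentially"
      using E.MCauchy_convergent_subsequence[OF y_cauchy \<phi>] by blast
    then have "limitin E.mtopology (\<sigma> \<circ> q) l sequentially"
      using limitin_subsequence[OF r, of E.mtopology y l] yr by (simp add: comp_def)
    then show "\<exists>l. limitin E.mtopology \<sigma> l sequentially"
      using E.MCauchy_convergent_subsequence[OF \<sigma> q] by blast
  qed
qed

lemma converges_to_of_chain_metric:
  assumes "converges_to (component x) chain_metric u l"
  shows "converges_to X d u l"
proof -
  interpret E: Metric_space "component x" chain_metric
    by (rule chain_metric_is_metric)
  have l: "l \<in> component x"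
    and lim: "\<forall>\<epsilon>>0. \<exists>N. \<forall>n\<ge>N. u n \<in> component x \<and> chain_metric (u n) l < \<epsilon>"
    using assms unfolding converges_to_def E.limit_metric_sequentially by auto
  show ?thesis
    unfolding converges_to_def limit_metric_sequentially
  proof (intro conjI allI impI)
    show "l \<in> X" using l component_subset by blast
    fix \<epsilon> :: real assume "\<epsilon> > 0"
    with lim obtain N
      where N: "\<And>n. N \<le> n \<Longrightarrow> u n \<in> component x \<and> chain_metric (u n) l < \<epsilon>" by blast
    have "u n \<in> X \<and> d (u n) l < \<epsilon>" if "N \<le> n" for n
    proof
      show "u n \<in> X" using N[OF that] component_subset by blast
      show "d (u n) l < \<epsilon>"
        using dist_le_chain_metric[OF component_joined[of "u n" x l]] N[OF that] l by simp
    qed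
    then show "\<exists>N. \<forall>n\<ge>N. u n \<in> X \<and> d (u n) l < \<epsilon>" by blast
  qed
qed

end

section \<open>The three deductions\<close>

lemma B_cp_msD:
  fixes X :: "'a set"
  assumes "B_cp_ms TYPE('a)" and "X \<noteq> {}" and "Metric_space X d" and "T \<in> X \<rightarrow> X"
    and "Metric_space.mcomplete X d" and "0 \<le> c" and "c < 1"
    and "\<And>x y. x \<in> X \<Longrightarrow> y \<in> X \<Longrightarrow> d (T x) (T y) \<le> c * d x y"
  shows "global_strongly_Picard X d T"
proof (rule assms(1)[unfolded B_cp_ms_def, rule_format])
  show "X \<noteq> {} \<and> Metric_space X d \<and> T \<in> X \<rightarrow> X"
    using assms(2-4) by (intro conjI)
  show "Metric_space.mcomplete X d \<and>
      (\<exists>\<alpha>. 0 \<le> \<alpha> \<and> \<alpha> < 1 \<and> (\<forall>x\<in>X. \<forall>y\<in>X. d (T x) (T y) \<le> \<alpha> * d x y))"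
    using assms(5-8) by (intro conjI exI[of _ c]) auto
qed

text \<open>
  The class of \<open>z\<close> is invariant under \<open>T\<close> as soon as one chain joins \<open>z\<close> to \<open>T z\<close>, since \<open>T\<close> maps a
  chain from \<open>z\<close> to \<open>y\<close> to a chain from \<open>T z\<close> to \<open>T y\<close>.
\<close>

lemma (in reflexive_symmetric_metric) Picard_on_component:
  assumes B: "B_cp_ms TYPE('a)" and c: "0 < c" "c < 1"
    and contr: "contractive X d S c T" and compl: "rel_complete X d S"
    and closed: "almost_selfclosed X d S" and incr: "rel_increasing X S T"
    and z: "(z, T z) \<in> S\<^sup>+"
  shows "global_strongly_Picard (component z) chain_metric T"
proof -
  have TS: "(T x, T y) \<in> S \<and> d (T x) (T y) \<le> c * d x y" if "(x, y) \<in> S" for x y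
    using that contr incr S_subset unfolding contractive_def rel_increasing_def by blast
  have T_trancl: "(T x, T y) \<in> S\<^sup>+" if "(x, y) \<in> S\<^sup>+" for x y
    using that by (induction rule: trancl_induct) (metis TS r_into_trancl trancl_into_trancl)+
  show ?thesis
  proof (rule B_cp_msD[OF B _ chain_metric_is_metric _ chain_metric_mcomplete[OF compl closed]])
    show "component z \<noteq> {}" using z by (auto simp: component_def)
    show "T \<in> component z \<rightarrow> component z"
      using trancl_trans[OF z T_trancl] by (simp add: component_def)
    show "0 \<le> c" "c < 1" using c by auto
    show "chain_metric (T x) (T y) \<le> c * chain_metric x y"
      if "x \<in> component z" "y \<in> component z" for x y
      by (rule chain_metric_contraction[OF component_joined[OF that] c(1) TS])
  qed
qed

lemma AI_lin_rsms_of_B_cp_ms: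
  assumes B: "B_cp_ms TYPE('a)"
  shows "AI_lin_rsms TYPE('a)"
  unfolding AI_lin_rsms_def
proof (intro allI impI, elim conjE exE)
  fix X :: "'a set" and d T and S :: "'a rel" and c
  assume M: "Metric_space X d"
    and S: "S \<subseteq> X \<times> X" "refl_on X S" "sym S" and c: "0 < c" "c < 1"
    and hyps: "contractive X d S c T" "rel_complete X d S" "almost_selfclosed X d S"
      "rel_increasing X S T"
  interpret reflexive_symmetric_metric X d S
    using M S by (simp add: reflexive_symmetric_metric.intro reflexive_symmetric_metric_axioms.intro)
  note Picard = Picard_on_component[OF B c hyps]
  show "rel_global_strongly_Picard X d (rel_omega X S) T"
    unfolding rel_omega_eq_trancl[OF S(1)] rel_global_strongly_Picard_def
  proof (intro conjI ballI impI)
    fix x assume "x \<in> progressive_points X T (S\<^sup>+)"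
    then have x: "x \<in> X" "(x, T x) \<in> S\<^sup>+" unfolding progressive_points_def by auto
    have "x \<in> component x"
      using x(1) S(2) by (auto simp: component_def refl_on_def)
    with Picard[OF x(2)] obtain l where "l \<in> Fix (component x) T"
      and "converges_to (component x) chain_metric (\<lambda>n. (T ^^ n) x) l"
      unfolding global_strongly_Picard_def by blast
    then show "\<exists>l\<in>Fix X T. converges_to X d (\<lambda>n. (T ^^ n) x) l"
      using converges_to_of_chain_metric component_subset unfolding Fix_def by blast
  next
    fix z1 z2 assume z: "z1 \<in> Fix X T" "z2 \<in> Fix X T" "(z1, z2) \<in> S\<^sup>+"
    then have "(z1, z1) \<in> S\<^sup>+"
      using S(2) by (auto simp: Fix_def refl_on_def)
    then have "z1 \<in> Fix (component z1) T" "z2 \<in> Fix (component z1) T" "(z1, T z1) \<in> S\<^sup>+"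
      using z by (auto simp: Fix_def component_def)
    then show "z1 = z2"
      using Picard unfolding global_strongly_Picard_def by blast
  qed
qed

lemma NL_lin_qoms_of_AI_lin_rsms:
  assumes "AI_lin_rsms TYPE('a)"
  shows "NL_lin_qoms TYPE('a)"
proof -
  have "comparable r \<subseteq> X \<times> X \<and> refl_on X (comparable r) \<and> sym (comparable r)"
    if "preorder_on X r" for X :: "'a set" and r
    using that unfolding preorder_on_def comparable_def refl_on_def sym_def by blast
  then show ?thesis
    using assms unfolding NL_lin_qoms_def AI_lin_rsms_def by meson
qed

lemma B_cp_ms_of_NL_lin_qoms:
  assumes NL: "NL_lin_qoms TYPE('a)"
  shows "B_cp_ms TYPE('a)"
  unfolding B_cp_ms_def
proof (intro allI impI, elim conjE exE)
  fix X :: "'a set" and d T \<alpha>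
  assume X: "X \<noteq> {}" and M: "Metric_space X d" and T: "T \<in> X \<rightarrow> X"
    and compl: "Metric_space.mcomplete X d"
    and \<alpha>: "0 \<le> \<alpha>" "\<alpha> < 1" "\<forall>x\<in>X. \<forall>y\<in>X. d (T x) (T y) \<le> \<alpha> * d x y"
  interpret Metric_space X d by (rule M)
  let ?R = "X \<times> X"
  have cmp: "comparable ?R = ?R" unfolding comparable_def by auto
  have omega: "rel_omega X ?R = ?R"
    by (simp add: rel_omega_eq_trancl trancl_id trans_def)
  have pre: "preorder_on X ?R"
    by (auto simp: preorder_on_def refl_on_def trans_def)
  have prog: "progressive_points X T ?R = X"
    unfolding progressive_points_def using T by auto
  \<comment> \<open>A contraction constant \<open>0\<close> has to be replaced by a positive one.\<close>
  have "contractive X d ?R (max \<alpha> (1 / 2)) T"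
    unfolding contractive_def
  proof (intro ballI impI)
    fix x y assume "x \<in> X" "y \<in> X"
    then have "d (T x) (T y) \<le> \<alpha> * d x y" using \<alpha>(3) by blast
    also have "\<dots> \<le> max \<alpha> (1 / 2) * d x y" by (intro mult_right_mono) auto
    finally show "d (T x) (T y) \<le> max \<alpha> (1 / 2) * d x y" .
  qed
  then have contr: "\<exists>c. 0 < c \<and> c < 1 \<and> contractive X d ?R c T"
    using \<alpha>(2) by (intro exI[of _ "max \<alpha> (1 / 2)"]) auto
  have rcompl: "rel_complete X d ?R"
    using compl limitin_mspace unfolding rel_complete_def mcomplete_def converges_to_def by blast
  have closed: "almost_selfclosed X d ?R"
    unfolding almost_selfclosed_def ascending_def converges_to_def
    using limitin_mspace strict_mono_id by blast
  have incr: "rel_increasing X ?R T"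
    using T unfolding rel_increasing_def by auto
  have semi: "semi_progressive X ?R T"
    unfolding semi_progressive_def prog by (rule X)
  have "rel_global_strongly_Picard X d ?R T"
    using NL[unfolded NL_lin_qoms_def, rule_format, of X d T ?R] X M T pre
      contr rcompl closed incr semi
    unfolding cmp omega by blast
  then show "global_strongly_Picard X d T"
    unfolding rel_global_strongly_Picard_def global_strongly_Picard_def prog
    by (auto simp: Fix_def)
qed

theorem proposition5p3:
  shows "(NL_lin_qoms TYPE('a) \<longrightarrow> B_cp_ms TYPE('a)) \<and>
         (AI_lin_rsms TYPE('a) \<longrightarrow> NL_lin_qoms TYPE('a)) \<and>
         (B_cp_ms TYPE('a) \<longrightarrow> AI_lin_rsms TYPE('a)) \<and>
         (B_cp_ms TYPE('a) \<longleftrightarrow> NL_lin_qoms TYPE('a)) \<and>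
         (NL_lin_qoms TYPE('a) \<longleftrightarrow> AI_lin_rsms TYPE('a)) \<and>
         (B_cp_ms TYPE('a) \<longleftrightarrow> AI_lin_rsms TYPE('a))"
  using B_cp_ms_of_NL_lin_qoms NL_lin_qoms_of_AI_lin_rsms AI_lin_rsms_of_B_cp_ms by blast

end
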